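(* There exists a constant $\varepsilon_0>0$ such that for every $\varepsilon$ with $0<\varepsilon<\varepsilon_0$, the random graph $G\sim G(n,\frac{1+\varepsilon}{n})$ with high probability contains an induced path of length $\frac{\varepsilon^2 n}{5}$.
   Context: $G(n,p)$ is the binomial random graph on $n$ vertices in which each pair of vertices is an edge independently with probability $p$. "With high probability" means with probability tending to $1$ as $n\to\infty$. The length of a path is its number of edges; an induced path in $G$ is a path which is an induced subgraph of $G$. *)

theory Defs
  imports "HOL-Probability.Probability"
begin

text \<open>A simple graph on the vertex set \<open>{..<n}\<close> is given by its edge set, a subset of \<open>pairs n\<close>.\<close>

definition pairs :: "nat \<Rightarrow> nat set set" where
  "pairs n = {e. e \<subseteq> {..<n} \<and> card e = 2}"

text \<open>\<^const>\<open>bernoulli_pmf\<close> truncates its parameter to \<open>[0, 1]\<close>, so \<open>gnp n p\<close> is defined for every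
  real \<open>p\<close> and is the usual \<open>G(n, p)\<close> if \<open>0 \<le> p \<le> 1\<close>.\<close>

definition gnp :: "nat \<Rightarrow> real \<Rightarrow> nat set set pmf" where
  "gnp n p = map_pmf (\<lambda>f. {e \<in> pairs n. f e})
     (Pi_pmf (pairs n) False (\<lambda>_. bernoulli_pmf p))"

definition path_edges :: "'a list \<Rightarrow> 'a set set" where
  "path_edges xs = {{xs ! i, xs ! Suc i} | i. Suc i < length xs}"

definition is_path :: "'a set \<Rightarrow> 'a set set \<Rightarrow> 'a list \<Rightarrow> bool" where
  "is_path V E xs \<longleftrightarrow> xs \<noteq> [] \<and> distinct xs \<and> set xs \<subseteq> V \<and> path_edges xs \<subseteq> E"

definition induced_edges :: "'a set set \<Rightarrow> 'a set \<Rightarrow> 'a set set" where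
  "induced_edges E S = {e \<in> E. e \<subseteq> S}"

definition induced_path :: "'a set \<Rightarrow> 'a set set \<Rightarrow> 'a list \<Rightarrow> bool" where
  "induced_path V E xs \<longleftrightarrow> is_path V E xs \<and> path_edges xs = induced_edges E (set xs)"

text \<open>The length counts edges, so a path of length \<open>k\<close> has \<open>k + 1\<close> vertices.\<close>

definition has_induced_path_of_length :: "'a set \<Rightarrow> 'a set set \<Rightarrow> nat \<Rightarrow> bool" where
  "has_induced_path_of_length V E k \<longleftrightarrow> (\<exists>xs. induced_path V E xs \<and> length xs = k + 1)"

end

theory Submission
  imports Defs
begin

text \<open>
  Depth-first search adapted to induced paths. A primary query asks whether the top of the stack is
  joined to an unseen vertex \<open>w\<close>; on success, secondary queries ask for further edges from \<open>w\<close> to the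
  stack, and \<open>w\<close> is pushed if there are none and discarded otherwise. The stack is always an induced
  path. After about \<open>\<epsilon> n\<^sup>2 / 2\<close> primary queries about \<open>(\<epsilon> + \<epsilon>\<^sup>2) n / 2\<close> vertices have been found, of
  which only \<open>O(\<epsilon>\<^sup>3 n)\<close> were discarded. If the stack never reached \<open>\<epsilon>\<^sup>2 n / 5\<close> vertices, then at least
  \<open>(\<epsilon> / 2 + 3 \<epsilon>\<^sup>2 / 10 - O(\<epsilon>\<^sup>3)) n\<close> vertices are finished. All pairs of a finished and an unseen vertex
  have been queried, which makes \<open>(\<epsilon> / 2 + \<epsilon>\<^sup>2 / 20 - O(\<epsilon>\<^sup>3)) n\<^sup>2\<close> primary queries: too many.

  Instead of running the search as a random process, the probability that the unrevealed part of the
  graph completes a long induced path is bounded below for every state of the search, by induction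
  along the search; a second-moment supermartingale bounds the probability of failure.
\<close>

section \<open>Random subsets and the exposure of one element\<close>

text \<open>Generalises \<open>gnp\<close> to an arbitrary ground set, so that the pairs not yet
  queried can be sampled on their own.\<close>

definition random_subset :: "'a set \<Rightarrow> real \<Rightarrow> 'a set pmf" where
  "random_subset A p = map_pmf (\<lambda>f. {e \<in> A. f e}) (Pi_pmf A False (\<lambda>_. bernoulli_pmf p))"

lemma gnp_eq_random_subset: "gnp n p = random_subset (pairs n) p"
  by (simp add: gnp_def random_subset_def)

lemma set_random_subset: "finite A \<Longrightarrow> X \<in> set_pmf (random_subset A p) \<Longrightarrow> X \<subseteq> A"
  by (auto simp: random_subset_def)

text \<open>Deferred decisions: by independence the answer for \<open>e\<close> can be drawn first,
  leaving a random subset of the remaining elements. This is what one query of the search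
  does.\<close>

lemma random_subset_expose:
  assumes "finite A" "e \<in> A"
  shows "random_subset A p =
    bind_pmf (bernoulli_pmf p)
      (\<lambda>b. map_pmf (\<lambda>X. if b then insert e X else X) (random_subset (A - {e}) p))"
proof -
  let ?q = "\<lambda>_. bernoulli_pmf p"
  have "Pi_pmf A False ?q = Pi_pmf (insert e (A - {e})) False ?q"
    using assms by (simp add: insert_absorb)
  also have "\<dots> = bind_pmf (bernoulli_pmf p)
      (\<lambda>b. map_pmf (\<lambda>f. f(e := b)) (Pi_pmf (A - {e}) False ?q))"
    using assms by (subst Pi_pmf_insert') (auto simp: map_pmf_def)
  finally have "random_subset A p = bind_pmf (bernoulli_pmf p)
      (\<lambda>b. map_pmf (\<lambda>f. {x \<in> A. (f(e := b)) x}) (Pi_pmf (A - {e}) False ?q))"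
    by (simp add: random_subset_def map_bind_pmf pmf.map_comp o_def)
  also have "\<dots> = bind_pmf (bernoulli_pmf p)
      (\<lambda>b. map_pmf (\<lambda>X. if b then insert e X else X) (random_subset (A - {e}) p))"
  proof (intro bind_pmf_cong refl)
    fix b
    show "map_pmf (\<lambda>f. {x \<in> A. (f(e := b)) x}) (Pi_pmf (A - {e}) False ?q) =
      map_pmf (\<lambda>X. if b then insert e X else X) (random_subset (A - {e}) p)"
      unfolding random_subset_def pmf.map_comp
      by (intro pmf.map_cong0) (use assms in auto)
  qed
  finally show ?thesis .
qed

lemma prob_random_subset_expose:
  assumes "finite A" "e \<in> A" "0 \<le> p" "p \<le> 1"
  shows "measure_pmf.prob (random_subset A p) {X. P X} =
    p * measure_pmf.prob (random_subset (A - {e}) p) {X. P (insert e X)} +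
    (1 - p) * measure_pmf.prob (random_subset (A - {e}) p) {X. P X}"
proof -
  let ?M = "random_subset (A - {e}) p"
  have "emeasure (random_subset A p) {X. P X} =
    ennreal (measure_pmf.prob ?M {X. P (insert e X)}) * ennreal p +
    ennreal (measure_pmf.prob ?M {X. P X}) * ennreal (1 - p)"
    using assms
    by (subst random_subset_expose[OF assms(1,2), of p], subst emeasure_bind_pmf)
      (simp add: measure_pmf.emeasure_eq_measure vimage_def)
  also have "\<dots> = ennreal (p * measure_pmf.prob ?M {X. P (insert e X)} +
      (1 - p) * measure_pmf.prob ?M {X. P X})"
    using assms by (simp add: ennreal_mult[symmetric] ennreal_plus[symmetric] mult.commute del: ennreal_plus)
  finally show ?thesis
    using assms by (simp add: measure_pmf.emeasure_eq_measure del: ennreal_plus)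
qed

section \<open>Pairs of vertices and paths with all inner pairs revealed\<close>

lemma finite_pairs: "finite (pairs n)"
  by (rule finite_subset[of _ "Pow {..<n}"]) (auto simp: pairs_def)

lemma doubleton_in_pairs: "x < n \<Longrightarrow> y < n \<Longrightarrow> x \<noteq> y \<Longrightarrow> {x, y} \<in> pairs n"
  by (auto simp: pairs_def)

text \<open>\<open>F\<close> collects pairs known to be edges and \<open>Z\<close> pairs known to be non-edges.\<close>

fun revealed_path :: "'a set set \<Rightarrow> 'a set set \<Rightarrow> 'a list \<Rightarrow> bool" where
  "revealed_path F Z [] = True"
| "revealed_path F Z [x] = True"
| "revealed_path F Z (x # y # zs) =
    ({x, y} \<in> F \<and> x \<notin> set (y # zs) \<and> (\<forall>z\<in>set zs. {x, z} \<in> Z) \<and> revealed_path F Z (y # zs))"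

lemma revealed_path_mono:
  "revealed_path F Z xs \<Longrightarrow> F \<subseteq> F' \<Longrightarrow> Z \<subseteq> Z' \<Longrightarrow> revealed_path F' Z' xs"
  by (induction F Z xs rule: revealed_path.induct) auto

lemma revealed_path_tl: "revealed_path F Z (x # xs) \<Longrightarrow> revealed_path F Z xs"
  by (cases xs) auto

lemma revealed_path_distinct: "revealed_path F Z xs \<Longrightarrow> distinct xs"
  by (induction F Z xs rule: revealed_path.induct) auto

lemma path_edges_Nil [simp]: "path_edges [] = {}"
  and path_edges_singleton [simp]: "path_edges [x] = {}"
  by (auto simp: path_edges_def)

lemma path_edges_Cons2: "path_edges (x # y # zs) = insert {x, y} (path_edges (y # zs))"
proof -
  have "path_edges (x # y # zs) = (\<lambda>i. {(x # y # zs) ! i, (x # y # zs) ! Suc i}) ` {..<Suc (length zs)}"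
    by (auto simp: path_edges_def)
  also have "\<dots> = insert {x, y} ((\<lambda>i. {(y # zs) ! i, (y # zs) ! Suc i}) ` {..<length zs})"
    by (simp add: lessThan_Suc_eq_insert_0 image_image)
  also have "(\<lambda>i. {(y # zs) ! i, (y # zs) ! Suc i}) ` {..<length zs} = path_edges (y # zs)"
    by (auto simp: path_edges_def)
  finally show ?thesis .
qed

lemma induced_edges_insert:
  assumes "\<And>e. e \<in> E \<Longrightarrow> card e = 2"
  shows "induced_edges E (insert x S) = induced_edges E S \<union> {{x, y} | y. y \<in> S \<and> {x, y} \<in> E}"
proof (intro equalityI subsetI)
  fix e assume e: "e \<in> induced_edges E (insert x S)"
  show "e \<in> induced_edges E S \<union> {{x, y} | y. y \<in> S \<and> {x, y} \<in> E}"
  proof (cases "x \<in> e")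
    case True
    moreover obtain a b where "e = {a, b}" "a \<noteq> b"
      using e assms card_2_iff[of e] by (auto simp: induced_edges_def)
    ultimately obtain y where y: "e = {x, y}" "y \<noteq> x" by auto
    then show ?thesis using e by (auto simp: induced_edges_def)
  next
    case False
    then show ?thesis using e by (auto simp: induced_edges_def)
  qed
next
  fix e assume "e \<in> induced_edges E S \<union> {{x, y} | y. y \<in> S \<and> {x, y} \<in> E}"
  then show "e \<in> induced_edges E (insert x S)"
    by (auto simp: induced_edges_def)
qed

text \<open>Consecutive pairs lie in \<open>F\<close> and all other pairs of the list in
  \<open>Z\<close>, so an edge set that contains \<open>F\<close> and avoids \<open>Z\<close> has no
  freedom left inside the list.\<close>

lemma revealed_path_path_edges:
  assumes "revealed_path F Z xs" "F \<subseteq> E" "E \<inter> Z = {}" "\<And>e. e \<in> E \<Longrightarrow> card e = 2"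
  shows "path_edges xs = induced_edges E (set xs)"
  using assms(1,2,3)
proof (induction F Z xs rule: revealed_path.induct)
  case (1 F Z)
  have "e \<noteq> {}" if "e \<in> E" for e
    using assms(4)[OF that] by auto
  then show ?case by (auto simp: induced_edges_def)
next
  case (2 F Z x)
  have "\<not> e \<subseteq> {x}" if "e \<in> E" for e
    using assms(4)[OF that] card_mono[of "{x}" e] by auto
  then show ?case by (auto simp: induced_edges_def)
next
  case (3 F Z x y zs)
  have IH: "path_edges (y # zs) = induced_edges E (set (y # zs))"
    using 3 by auto
  have "{{x, v} | v. v \<in> set (y # zs) \<and> {x, v} \<in> E} = {{x, y}}"
    using 3(2-4) by auto
  moreover have "set (x # y # zs) = insert x (set (y # zs))"
    by simp
  ultimately have "induced_edges E (set (x # y # zs)) = induced_edges E (set (y # zs)) \<union> {{x, y}}"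
    using induced_edges_insert[of E x "set (y # zs)"] assms(4) by presburger
  then show ?case
    by (simp only: path_edges_Cons2 IH) blast
qed

lemma revealed_path_induced_path:
  assumes "revealed_path F Z xs" "F \<subseteq> E" "E \<inter> Z = {}" "\<And>e. e \<in> E \<Longrightarrow> card e = 2"
    and "xs \<noteq> []" "set xs \<subseteq> V"
  shows "induced_path V E xs"
proof -
  have "path_edges xs = induced_edges E (set xs)"
    by (rule revealed_path_path_edges[OF assms(1-4)])
  then show ?thesis
    using assms(5,6) revealed_path_distinct[OF assms(1)]
    by (auto simp: induced_path_def is_path_def induced_edges_def)
qed


section \<open>The parameters, the risk and the invariant of the search\<close>

text \<open>Separates the search from the numerical estimates, which enter only as
  \<open>no_dead_end\<close>. There \<open>x\<close>, \<open>t\<close>, \<open>u\<close>,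
  \<open>d\<close> count finished, unseen, stacked and discarded vertices, \<open>a\<close> and
  \<open>c\<close> primary and secondary queries, \<open>b\<close> primary successes. The target is
  a path on \<open>L\<close> vertices; \<open>N\<close> and \<open>s\<close> cap the primary queries
  and the finished vertices, and \<open>l\<close> is the tolerated deviation.\<close>

locale induced_search =
  fixes n L N s :: nat and p l :: real
  assumes p_range: "0 \<le> p" "p \<le> 1" and l_pos: "0 < l" and L_pos: "0 < L"
    and no_dead_end: "\<And>x t u a b c d. \<lbrakk>x + t + u + d = n; b \<le> x + u + d; x * t \<le> a; u < L;
      a \<le> N; x \<le> s; c \<le> L * b; a = N \<or> x = s \<or> u = 0 \<and> t = 0;
      \<bar>real b - p * real a\<bar> \<le> l; \<bar>real d - p * real c\<bar> \<le> l\<rbrakk> \<Longrightarrow> False"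
begin

text \<open>The numerator is a supermartingale: if \<open>b\<close> of the first \<open>a\<close> primary and \<open>d\<close> of the
  first \<open>c\<close> secondary queries are edges, then \<open>b - p a\<close> and \<open>d - p c\<close> are martingales whose
  squares grow by at most \<open>p\<close> per query in expectation.\<close>

definition risk :: "nat \<Rightarrow> nat \<Rightarrow> nat \<Rightarrow> nat \<Rightarrow> real" where
  "risk a b c d = ((real b - p * real a)\<^sup>2 + p * (real N - real a) +
     (real d - p * real c)\<^sup>2 + p * (real (L * n) - real c)) / l\<^sup>2"

lemma risk_primary: "p * risk (Suc a) (Suc b) c d + (1 - p) * risk (Suc a) b c d \<le> risk a b c d"
proof -
  \<comment> \<open>The answer adds its variance \<open>p * (1 - p)\<close> to the expected square,
    while the compensator loses \<open>p\<close>; the difference is the surplus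
    \<open>p\<^sup>2\<close>.\<close>
  have "p * (risk (Suc a) (Suc b) c d * l\<^sup>2) + (1 - p) * (risk (Suc a) b c d * l\<^sup>2) =
      risk a b c d * l\<^sup>2 - p\<^sup>2"
    using l_pos by (simp add: risk_def) algebra
  then have "(p * risk (Suc a) (Suc b) c d + (1 - p) * risk (Suc a) b c d) * l\<^sup>2 =
      risk a b c d * l\<^sup>2 - p\<^sup>2"
    by (simp only: distrib_right mult.assoc)
  then have "(p * risk (Suc a) (Suc b) c d + (1 - p) * risk (Suc a) b c d) * l\<^sup>2 \<le> risk a b c d * l\<^sup>2"
    by simp
  then show ?thesis
    using l_pos by simp
qed

lemma risk_secondary: "p * risk a b (Suc c) (Suc d) + (1 - p) * risk a b (Suc c) d \<le> risk a b c d"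
proof -
  have "p * (risk a b (Suc c) (Suc d) * l\<^sup>2) + (1 - p) * (risk a b (Suc c) d * l\<^sup>2) =
      risk a b c d * l\<^sup>2 - p\<^sup>2"
    using l_pos by (simp add: risk_def) algebra
  then have "(p * risk a b (Suc c) (Suc d) + (1 - p) * risk a b (Suc c) d) * l\<^sup>2 =
      risk a b c d * l\<^sup>2 - p\<^sup>2"
    by (simp only: distrib_right mult.assoc)
  then have "(p * risk a b (Suc c) (Suc d) + (1 - p) * risk a b (Suc c) d) * l\<^sup>2 \<le> risk a b c d * l\<^sup>2"
    by simp
  then show ?thesis
    using l_pos by simp
qed

lemma risk_nonneg: "a \<le> N \<Longrightarrow> c \<le> L * n \<Longrightarrow> 0 \<le> risk a b c d"
  using p_range by (simp add: risk_def del: of_nat_mult)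

lemma risk_ge_1:
  assumes "a \<le> N" "c \<le> L * n" "l < \<bar>real b - p * real a\<bar> \<or> l < \<bar>real d - p * real c\<bar>"
  shows "1 \<le> risk a b c d"
proof -
  have *: "l\<^sup>2 \<le> x\<^sup>2" if "l < \<bar>x\<bar>" for x
    using that l_pos abs_le_square_iff[of l x] by simp
  have "0 \<le> p * (real N - real a)" "0 \<le> p * (real (L * n) - real c)"
    using assms p_range by (simp_all del: of_nat_mult)
  moreover have "l\<^sup>2 \<le> (real b - p * real a)\<^sup>2 + (real d - p * real c)\<^sup>2"
    using assms(3) *[of "real b - p * real a"] *[of "real d - p * real c"]
    by (smt (verit) zero_le_power2)
  ultimately have "l\<^sup>2 \<le> (real b - p * real a)\<^sup>2 + p * (real N - real a) +
     (real d - p * real c)\<^sup>2 + p * (real (L * n) - real c)"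
    by linarith
  then show ?thesis
    using l_pos by (simp add: risk_def)
qed

text \<open>A state consists of the stack \<open>U\<close>, the unseen vertices \<open>T\<close>, the finished vertices \<open>S\<close>,
  the pairs \<open>P\<close> and \<open>Q\<close> of primary and secondary queries, the set \<open>B\<close> of edges found so far,
  and the numbers \<open>b\<close> and \<open>d\<close> of successful primary and secondary queries. Since every
  successful secondary query discards a vertex, \<open>d\<close> also counts the discarded vertices.\<close>

definition search_inv where
  "search_inv U T S P Q B b d \<longleftrightarrow>
     set U \<subseteq> {..<n} \<and> T \<subseteq> {..<n} \<and> S \<subseteq> {..<n} \<and> set U \<inter> T = {} \<and> S \<inter> T = {} \<and> S \<inter> set U = {} \<and>
     card S + card T + length U + d = n \<and> b \<le> card S + length U + d \<and>
     P \<subseteq> pairs n \<and> Q \<subseteq> pairs n \<and> B \<subseteq> P \<union> Q \<and>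
     (\<forall>x\<in>S. \<forall>t\<in>T. {x, t} \<in> P) \<and> (\<forall>e\<in>Q. e \<inter> T = {}) \<and> (\<forall>e\<in>B. e \<inter> T = {}) \<and>
     revealed_path B ((P \<union> Q) - B) U \<and>
     length U \<le> L \<and> card P \<le> N \<and> card S \<le> s \<and> card Q \<le> L * b"

text \<open>The invariant gives \<open>b \<le> n\<close>, as each primary success accounts for a
  different vertex. Hence the budget \<open>L * n\<close> for secondary queries in
  \<open>risk\<close>.\<close>

lemma search_inv_card_Q: "search_inv U T S P Q B b d \<Longrightarrow> card Q \<le> L * n"
  by (smt (verit) le_add1 le_trans mult_le_mono2 search_inv_def add.commute add.left_commute)

lemma search_inv_card_prod:
  assumes "search_inv U T S P Q B b d"
  shows "card S * card T \<le> card P"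
proof -
  have "inj_on (\<lambda>(x, t). {x, t}) (S \<times> T)"
    using assms by (auto simp: inj_on_def search_inv_def doubleton_eq_iff)
  moreover have "(\<lambda>(x, t). {x, t}) ` (S \<times> T) \<subseteq> P"
    using assms by (auto simp: search_inv_def)
  moreover have "finite P"
    using assms finite_pairs finite_subset by (auto simp: search_inv_def)
  ultimately show ?thesis
    by (metis card_cartesian_product card_inj_on_le)
qed

section \<open>The success probability of a state and its change under one query\<close>

text \<open>Replaces conditioning on the past: with \<open>A\<close> the unqueried pairs and
  \<open>B\<close> the edges found, this is the chance of a path on \<open>L\<close> vertices given
  all answers so far.\<close>

definition success :: "nat set set \<Rightarrow> nat set set \<Rightarrow> real" where
  "success A B = measure_pmf.prob (random_subset A p) {X. \<exists>xs. induced_path {..<n} (B \<union> X) xs \<and> length xs = L}"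

lemma success_nonneg: "0 \<le> success A B"
  by (simp add: success_def)

lemma success_expose:
  assumes "R \<subseteq> pairs n" "e \<in> pairs n - R"
  shows "success (pairs n - R) B =
    p * success (pairs n - insert e R) (insert e B) + (1 - p) * success (pairs n - insert e R) B"
proof -
  have "pairs n - R - {e} = pairs n - insert e R" by auto
  then show ?thesis
    unfolding success_def
    by (subst prob_random_subset_expose[of _ e]) (use assms p_range finite_pairs in auto)
qed

text \<open>All pairs inside the stack have been queried, so no unrevealed edge can become a
  chord.\<close>

lemma success_complete:
  assumes "search_inv U T S P Q B b d" "length U = L"
  shows "success (pairs n - (P \<union> Q)) B = 1"
proof -
  have "\<exists>xs. induced_path {..<n} (B \<union> X) xs \<and> length xs = L"
    if "X \<in> set_pmf (random_subset (pairs n - (P \<union> Q)) p)" for X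
  proof -
    have X: "X \<subseteq> pairs n - (P \<union> Q)"
      using set_random_subset[OF _ that] finite_pairs by blast
    have "induced_path {..<n} (B \<union> X) U"
    proof (rule revealed_path_induced_path)
      show "revealed_path B (P \<union> Q - B) U"
        using assms by (simp add: search_inv_def)
      show "card e = 2" if "e \<in> B \<union> X" for e
        using that X assms by (auto simp: search_inv_def pairs_def)
    qed (use X assms L_pos in \<open>auto simp: search_inv_def\<close>)
    with assms show ?thesis by blast
  qed
  then show ?thesis
    unfolding success_def by (subst measure_pmf.prob_eq_1) (auto simp: AE_measure_pmf_iff)
qed

text \<open>If the stack is not full, \<open>no_dead_end\<close> forces one of the deviations above
  \<open>l\<close>; then the risk is at least 1 and the bound is trivial.\<close>

lemma success_halted:
  assumes inv: "search_inv U T S P Q B b d"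
    and halt: "length U = L \<or> card P = N \<or> card S = s \<or> U = [] \<and> T = {}"
  shows "1 - risk (card P) b (card Q) d \<le> success (pairs n - (P \<union> Q)) B"
proof (cases "length U = L")
  case True
  then show ?thesis
    using success_complete[OF inv] risk_nonneg search_inv_card_Q[OF inv] inv
    by (simp add: search_inv_def)
next
  case False
  have "l < \<bar>real b - p * real (card P)\<bar> \<or> l < \<bar>real d - p * real (card Q)\<bar>"
  proof (rule ccontr)
    assume *: "\<not> ?thesis"
    show False
    proof (rule no_dead_end)
      show "card S * card T \<le> card P"
        by (rule search_inv_card_prod[OF inv])
      show "card P = N \<or> card S = s \<or> length U = 0 \<and> card T = 0"
        using halt False by auto
      show "\<bar>real b - p * real (card P)\<bar> \<le> l" "\<bar>real d - p * real (card Q)\<bar> \<le> l"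
        using * by auto
    qed (use inv False in \<open>simp_all add: search_inv_def\<close>)
  qed
  then have "1 \<le> risk (card P) b (card Q) d"
    using risk_ge_1 search_inv_card_Q[OF inv] inv by (simp add: search_inv_def)
  then show ?thesis
    using success_nonneg[of "pairs n - (P \<union> Q)" B] by linarith
qed

text \<open>One query in the induction: \<open>x\<close> and \<open>y\<close> are the risks after a
  hit and a miss, \<open>z\<close> the risk before it.\<close>

lemma success_convex:
  assumes "R \<subseteq> pairs n" "e \<in> pairs n - R"
    and "1 - x \<le> success (pairs n - insert e R) (insert e B)"
    and "1 - y \<le> success (pairs n - insert e R) B"
    and "p * x + (1 - p) * y \<le> z"
  shows "1 - z \<le> success (pairs n - R) B"
proof -
  have "p * (1 - x) + (1 - p) * (1 - y) \<le> success (pairs n - R) B"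
    unfolding success_expose[OF assms(1,2)]
    using assms(3,4) p_range by (intro add_mono mult_left_mono) auto
  then show ?thesis
    using assms(5) by (simp add: algebra_simps)
qed

text \<open>The secondary queries compare the vertex \<open>w\<close>, found from the top \<open>v\<close> of the stack, with
  the rest of the stack; \<open>R\<close> is the part of the stack still to be compared.\<close>

lemma success_secondary:
  assumes push: "\<And>Q. search_inv (w # v # us) T S P Q B b d \<Longrightarrow>
      1 - risk (card P) b (card Q) d \<le> success (pairs n - (P \<union> Q)) B"
    and discard: "\<And>Q B. search_inv (v # us) T S P Q B b (Suc d) \<Longrightarrow>
      1 - risk (card P) b (card Q) (Suc d) \<le> success (pairs n - (P \<union> Q)) B"
    and geom: "set (w # v # us) \<subseteq> {..<n}" "T \<subseteq> {..<n}" "S \<subseteq> {..<n}" "w \<notin> set (v # us)"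
      "set (w # v # us) \<inter> T = {}" "S \<inter> T = {}" "S \<inter> set (w # v # us) = {}"
    and count: "card S + card T + length (v # us) + Suc d = n" "b \<le> card S + length (v # us) + Suc d"
      "length (v # us) < L" "card P \<le> N" "card S \<le> s"
    and queried: "P \<subseteq> pairs n" "B \<subseteq> P \<union> Q0" "{w, v} \<in> B"
      "\<forall>x\<in>S. \<forall>t\<in>T. {x, t} \<in> P" "\<forall>e\<in>B. e \<inter> T = {}"
      "\<forall>u\<in>set us. {w, u} \<notin> B" "revealed_path B ((P \<union> Q0) - B) (v # us)"
    and secondary: "Q0 \<subseteq> Q" "Q \<subseteq> pairs n" "\<forall>e\<in>Q. e \<inter> T = {}"
      "set R \<subseteq> set us" "\<forall>u\<in>set us - set R. {w, u} \<in> P \<union> Q" "card Q + length R \<le> L * b"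
  shows "1 - risk (card P) b (card Q) d \<le> success (pairs n - (P \<union> Q)) B"
  using secondary
\<comment> \<open>\<open>B\<close> stays fixed, since a hit ends the comparison by discarding
  \<open>w\<close>; only \<open>Q\<close> grows.\<close>
proof (induction R arbitrary: Q)
  case Nil
  have "revealed_path B ((P \<union> Q) - B) (v # us)"
    using Nil queried by (intro revealed_path_mono[OF queried(7)]) auto
  then have "revealed_path B ((P \<union> Q) - B) (w # v # us)"
    using Nil queried geom by auto
  moreover have "card Q \<le> L * b" "B \<subseteq> P \<union> Q"
    using Nil queried(2) by auto
  ultimately have "search_inv (w # v # us) T S P Q B b d"
    unfolding search_inv_def using geom count queried(1,4,5) Nil(2,3)
    by (intro conjI; (assumption | simp))
  then show ?case by (rule push)
next
  case (Cons u R)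
  let ?e = "{w, u}"
  show ?case
  proof (cases "?e \<in> P \<union> Q")
    \<comment> \<open>Here the answer is already known to be negative, because \<open>{w, u}\<close>
      is not in \<open>B\<close>; the query is skipped.\<close>
    case True
    then show ?thesis
      using Cons.prems by (intro Cons.IH) auto
  next
    case False
    have u: "u \<in> set us" "u < n" "w < n" "u \<noteq> w" "u \<notin> T" "w \<notin> T"
      using Cons.prems geom by auto
    have e: "?e \<in> pairs n" "?e \<inter> T = {}"
      using u by (auto intro: doubleton_in_pairs)
    have fin: "finite Q"
      by (rule finite_subset[OF _ finite_pairs]) (use Cons.prems in auto)
    have card: "card (insert ?e Q) = Suc (card Q)"
      using False fin by simp
    have "revealed_path (insert ?e B) ((P \<union> insert ?e Q) - insert ?e B) (v # us)"
      using Cons.prems queried False by (intro revealed_path_mono[OF queried(7)]) auto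
    moreover have "card (insert ?e Q) \<le> L * b" "insert ?e B \<subseteq> P \<union> insert ?e Q"
      "insert ?e Q \<subseteq> pairs n"
      using Cons.prems(1,2,6) queried(2) card e by auto
    moreover have "\<forall>x\<in>insert ?e Q. x \<inter> T = {}" "\<forall>x\<in>insert ?e B. x \<inter> T = {}"
      using Cons.prems(3) queried(5) e by blast+
    ultimately have "search_inv (v # us) T S P (insert ?e Q) (insert ?e B) b (Suc d)"
      unfolding search_inv_def using geom count queried(1,4)
      by (intro conjI; (assumption | simp))
    from discard[OF this]
    have hit: "1 - risk (card P) b (Suc (card Q)) (Suc d) \<le>
        success (pairs n - insert ?e (P \<union> Q)) (insert ?e B)"
      by (simp add: card)
    have "1 - risk (card P) b (card (insert ?e Q)) d \<le> success (pairs n - (P \<union> insert ?e Q)) B"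
      using Cons.prems e card by (intro Cons.IH) auto
    then have miss: "1 - risk (card P) b (Suc (card Q)) d \<le> success (pairs n - insert ?e (P \<union> Q)) B"
      by (simp add: card)
    show ?thesis
      by (rule success_convex[OF _ _ hit miss risk_secondary]) (use queried(1) Cons.prems(2) e False in auto)
  qed
qed

section \<open>The moves of the search and the induction along it\<close>

text \<open>A root joins the stack without a query, which is why \<open>b\<close> only bounds from
  below the number of vertices that have left \<open>T\<close>.\<close>

lemma search_inv_root:
  assumes "search_inv [] T S P Q B b d" "x \<in> T"
  shows "search_inv [x] (T - {x}) S P Q B b d"
proof -
  note inv = assms(1)[unfolded search_inv_def]
  have "card T = Suc (card (T - {x}))"
    using inv assms(2) by (intro card.remove) (auto intro: finite_subset)
  then show ?thesis
    unfolding search_inv_def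
    by (intro conjI) (use inv assms(2) L_pos in auto)
qed

lemma search_inv_pop:
  assumes inv: "search_inv (v # us) T S P Q B b d"
    and "\<forall>t\<in>T. {v, t} \<in> P \<union> Q" "card S < s"
  shows "search_inv us T (insert v S) P Q B b d"
proof -
  have vertices: "set us \<subseteq> {..<n}" "T \<subseteq> {..<n}" "insert v S \<subseteq> {..<n}"
      "set us \<inter> T = {}" "insert v S \<inter> T = {}" "S \<inter> set (v # us) = {}"
    and count: "card S + card T + length (v # us) + d = n" "b \<le> card S + length (v # us) + d"
      "length (v # us) \<le> L" "card P \<le> N" "card Q \<le> L * b"
    and queried: "P \<subseteq> pairs n" "Q \<subseteq> pairs n" "B \<subseteq> P \<union> Q" "\<forall>x\<in>S. \<forall>t\<in>T. {x, t} \<in> P"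
      "\<forall>e\<in>Q. e \<inter> T = {}" "\<forall>e\<in>B. e \<inter> T = {}" "revealed_path B (P \<union> Q - B) (v # us)"
    using inv unfolding search_inv_def by simp_all
  have "card (insert v S) = Suc (card S)"
    using vertices(3,6) finite_subset[of S "{..<n}"] by simp
  then have count': "card (insert v S) + card T + length us + d = n"
      "b \<le> card (insert v S) + length us + d" "length us \<le> L" "card (insert v S) \<le> s"
    using count assms(3) by simp_all
  \<comment> \<open>Pairs in \<open>Q\<close> never meet \<open>T\<close>, so the query of
    \<open>{v, t}\<close> was primary and counts towards \<open>card P\<close>.\<close>
  have "{v, t} \<in> P" if "t \<in> T" for t
  proof -
    have "{v, t} \<inter> T \<noteq> {}"
      using that by simp
    then have "{v, t} \<notin> Q"
      using queried(5) by metis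
    then show ?thesis
      using that assms(2) by blast
  qed
  then have vP: "\<forall>x\<in>insert v S. \<forall>t\<in>T. {x, t} \<in> P"
    using queried(4) by simp
  have "v \<notin> set us"
    using revealed_path_distinct[OF queried(7)] by simp
  then have "insert v S \<inter> set us = {}"
    using vertices(6) by simp
  then show ?thesis
    unfolding search_inv_def
    by (intro conjI vertices count count' queried vP revealed_path_tl[OF queried(7)])
qed

lemma search_inv_miss:
  assumes inv: "search_inv U T S P Q B b d"
    and e: "e \<in> pairs n" "e \<notin> P \<union> Q" and "card P < N"
  shows "search_inv U T S (insert e P) Q B b d"
proof -
  note inv' = inv[unfolded search_inv_def]
  have P: "P \<subseteq> pairs n" and B: "B \<subseteq> P \<union> Q" and path: "revealed_path B (P \<union> Q - B) U"
    using inv' by - (elim conjE, assumption)+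
  have "card (insert e P) \<le> N"
    using e assms(4) finite_subset[OF P finite_pairs] by simp
  moreover have "insert e P \<subseteq> pairs n" "B \<subseteq> insert e P \<union> Q"
    using P B e by auto
  moreover have "revealed_path B ((insert e P \<union> Q) - B) U"
    using B e by (intro revealed_path_mono[OF path]) auto
  ultimately show ?thesis
    unfolding search_inv_def using inv'
    by (elim conjE; intro conjI; (assumption | simp))
qed

lemma success_search:
  assumes "search_inv U T S P Q B b d"
  shows "1 - risk (card P) b (card Q) d \<le> success (pairs n - (P \<union> Q)) B"
  using assms
\<comment> \<open>An unseen vertex weighs 2 and a stacked one 1, so starting from a root, pushing,
  discarding and popping all lower the measure; a miss lowers the last summand.\<close>
proof (induction "2 * card T + length U + (N - card P)" arbitrary: U T S P Q B b d rule: less_induct)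
  case less
  note inv = less.prems[unfolded search_inv_def]
  have vertices: "set U \<subseteq> {..<n}" "T \<subseteq> {..<n}" "S \<subseteq> {..<n}"
      "set U \<inter> T = {}" "S \<inter> T = {}" "S \<inter> set U = {}"
    and count: "card S + card T + length U + d = n" "b \<le> card S + length U + d"
      "length U \<le> L" "card P \<le> N" "card S \<le> s" "card Q \<le> L * b"
    and queried: "P \<subseteq> pairs n" "Q \<subseteq> pairs n" "B \<subseteq> P \<union> Q" "\<forall>x\<in>S. \<forall>t\<in>T. {x, t} \<in> P"
      "\<forall>e\<in>Q. e \<inter> T = {}" "\<forall>e\<in>B. e \<inter> T = {}" "revealed_path B (P \<union> Q - B) U"
    using inv by - (elim conjE, assumption)+
  have fin: "finite T" "finite P"
    using vertices(2) queried(1) by (auto intro: finite_subset finite_subset[OF _ finite_pairs])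
  have PQ: "P \<union> Q \<subseteq> pairs n"
    using queried(1,2) by simp
  show ?case
  proof (cases "length U = L \<or> card P = N \<or> card S = s \<or> U = [] \<and> T = {}")
    case True
    then show ?thesis by (rule success_halted[OF less.prems])
  next
    case running: False
    then have bounds: "length U < L" "card P < N" "card S < s"
      using count by auto
    show ?thesis
    proof (cases U)
      case Nil
      then obtain x where x: "x \<in> T" using running by auto
      have "card T = Suc (card (T - {x}))"
        by (rule card.remove[OF fin(1) x])
      moreover have "search_inv [x] (T - {x}) S P Q B b d"
        using search_inv_root less.prems x Nil by simp
      ultimately show ?thesis
        using Nil by (intro less.hyps) auto
    next
      case (Cons v us)
      show ?thesis
      proof (cases "\<forall>t\<in>T. {v, t} \<in> P \<union> Q")
        case True
        then have "search_inv us T (insert v S) P Q B b d"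
          using search_inv_pop less.prems bounds(3) Cons by simp
        then show ?thesis
          using Cons by (intro less.hyps) auto
      next
        case False
        then obtain w where w: "w \<in> T" "{v, w} \<notin> P \<union> Q" by blast
        let ?e = "{v, w}"
        have vw: "v < n" "w < n" "v \<noteq> w" "v \<notin> T" "w \<notin> set U"
          using w(1) vertices Cons by auto
        have e: "?e \<in> pairs n"
          using vw by (intro doubleton_in_pairs)
        have card: "card (insert ?e P) = Suc (card P)"
          using w(2) fin by simp
        have cardT: "card T = Suc (card (T - {w}))"
          by (rule card.remove[OF fin(1) w(1)])
        have "search_inv U T S (insert ?e P) Q B b d"
          using search_inv_miss[OF less.prems e w(2) bounds(2)] .
        moreover have "2 * card T + length U + (N - card (insert ?e P)) <
            2 * card T + length U + (N - card P)"
          using card bounds(2) by simp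
        ultimately have miss: "1 - risk (Suc (card P)) b (card Q) d \<le>
            success (pairs n - insert ?e (P \<union> Q)) B"
          using less.hyps[of T U "insert ?e P" S Q B b d] card by simp
        have "1 - risk (card (insert ?e P)) (Suc b) (card Q) d \<le>
            success (pairs n - (insert ?e P \<union> Q)) (insert ?e B)"
        proof (rule success_secondary[where w = w and v = v and us = us and T = "T - {w}" and S = S
              and ?Q0.0 = Q and R = us])
          show "1 - risk (card (insert ?e P)) (Suc b) (card Q') d \<le>
              success (pairs n - (insert ?e P \<union> Q')) (insert ?e B)"
            if "search_inv (w # v # us) (T - {w}) S (insert ?e P) Q' (insert ?e B) (Suc b) d" for Q'
            using card cardT Cons bounds(2) by (intro less.hyps[OF _ that]) simp
          show "1 - risk (card (insert ?e P)) (Suc b) (card Q') (Suc d) \<le>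
              success (pairs n - (insert ?e P \<union> Q')) B'"
            if "search_inv (v # us) (T - {w}) S (insert ?e P) Q' B' (Suc b) (Suc d)" for Q' B'
            using card cardT Cons bounds(2) by (intro less.hyps[OF _ that]) simp
          show "set (w # v # us) \<subseteq> {..<n}" "w \<notin> set (v # us)" "set (w # v # us) \<inter> (T - {w}) = {}"
            "S \<inter> (T - {w}) = {}" "S \<inter> set (w # v # us) = {}" "T - {w} \<subseteq> {..<n}" "S \<subseteq> {..<n}"
            using vertices vw w(1) Cons by auto
          \<comment> \<open>\<open>w\<close> has left \<open>T\<close> but is not yet placed;
            \<open>Suc d\<close> counts it as discarded, and pushing it gives the same total. The
            new success pays for the at most \<open>length us\<close> secondary queries.\<close>
          show "card S + card (T - {w}) + length (v # us) + Suc d = n"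
            "Suc b \<le> card S + length (v # us) + Suc d"
            "length (v # us) < L" "card (insert ?e P) \<le> N" "card S \<le> s"
            "card Q + length us \<le> L * Suc b"
            using count bounds Cons card cardT by simp_all
          show "insert ?e P \<subseteq> pairs n" "Q \<subseteq> pairs n" "insert ?e B \<subseteq> insert ?e P \<union> Q"
            using queried(1-3) e by auto
          show "\<forall>x\<in>S. \<forall>t\<in>T - {w}. {x, t} \<in> insert ?e P"
            using queried(4) by simp
          have shrink: "e \<inter> (T - {w}) = {}" if "e \<inter> T = {}" for e
            using that by blast
          then show "\<forall>e\<in>Q. e \<inter> (T - {w}) = {}"
            using queried(5) by simp
          have "?e \<inter> (T - {w}) = {}"
            using vw(4) by simp
          then show "\<forall>e\<in>insert ?e B. e \<inter> (T - {w}) = {}"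
            using shrink queried(6) by simp
          have "v \<notin> set us"
            using Cons revealed_path_distinct[OF queried(7)] by simp
          moreover have "{w, u} \<notin> B" for u
          proof -
            have "{w, u} \<inter> T \<noteq> {}"
              using w(1) by simp
            then show ?thesis
              using queried(6) by metis
          qed
          ultimately show "\<forall>u\<in>set us. {w, u} \<notin> insert ?e B"
            using vw(3) by (auto simp: doubleton_eq_iff)
          show "revealed_path (insert ?e B) (insert ?e P \<union> Q - insert ?e B) (v # us)"
            by (rule revealed_path_mono[OF queried(7)[unfolded Cons]]) (use w(2) queried(3) in auto)
        qed (simp_all add: insert_commute)
        then have hit: "1 - risk (Suc (card P)) (Suc b) (card Q) d \<le>
            success (pairs n - insert ?e (P \<union> Q)) (insert ?e B)"
          by (simp add: card)
        show ?thesis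
          by (rule success_convex[OF PQ _ hit miss risk_primary]) (use w(2) e in simp)
      qed
    qed
  qed
qed

end

section \<open>The numerical contradiction\<close>

text \<open>All counts are divided by \<open>n\<close>, and the numbers of queries by \<open>n\<^sup>2\<close>; \<open>\<eta>\<close> absorbs rounding.\<close>

lemma no_dead_end_scaled:
  fixes \<epsilon> \<eta> x t u a b c d :: real
  assumes \<epsilon>: "0 < \<epsilon>" "\<epsilon> \<le> 1 / 100" and \<eta>: "0 \<le> \<eta>" "\<eta> \<le> \<epsilon> ^ 3 / 1000"
    and nonneg: "0 \<le> u" "0 \<le> a" "0 \<le> b" "0 \<le> d" "0 \<le> x"
    and sum: "x + t + u + d = 1" and roots: "b \<le> x + u + d" and prod: "x * t \<le> a"
    and u: "u \<le> \<epsilon>\<^sup>2 / 5 + \<eta>" and a: "a \<le> \<epsilon> / 2" and x: "x \<le> \<epsilon> + \<eta>"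
    and c: "c \<le> (\<epsilon>\<^sup>2 / 5 + 2 * \<eta>) * b"
    and primary: "\<bar>b - (1 + \<epsilon>) * a\<bar> \<le> \<epsilon> ^ 3 / 10"
    and secondary: "\<bar>d - (1 + \<epsilon>) * c\<bar> \<le> \<epsilon> ^ 3 / 10"
    and halt: "\<epsilon> / 2 - \<eta> \<le> a \<or> \<epsilon> \<le> x \<or> u = 0 \<and> t = 0"
  shows False
proof -
  have e2: "\<epsilon>\<^sup>2 \<le> \<epsilon> / 100" "0 < \<epsilon>\<^sup>2"
    using \<epsilon> by (auto simp: power2_eq_square)
  have e3: "\<epsilon> ^ 3 \<le> \<epsilon>\<^sup>2 / 100" "0 < \<epsilon> ^ 3" "\<epsilon> ^ 3 = \<epsilon> * \<epsilon>\<^sup>2"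
    using \<epsilon> by (auto simp: power2_eq_square power3_eq_cube)
  have "(1 + \<epsilon>) * a \<le> (1 + \<epsilon>) * (\<epsilon> / 2)"
    using \<epsilon> a by (intro mult_left_mono) auto
  also have "\<dots> = \<epsilon> / 2 + \<epsilon>\<^sup>2 / 2"
    by (simp add: algebra_simps power2_eq_square)
  finally have b: "b \<le> 51 / 100 * \<epsilon>"
    using primary e2 e3 by linarith
  \<comment> \<open>To leading order \<open>c\<close> is at most \<epsilon>^2/5 times \<epsilon>/2,
    that is \<epsilon>^3/10; adding the deviation \<epsilon>^3/10 keeps \<open>d\<close> below
    \<epsilon>^3/4.\<close>
  have "c \<le> (\<epsilon>\<^sup>2 / 5 + 2 * \<eta>) * b"
    by (rule c)
  also have "\<dots> \<le> (21 / 100 * \<epsilon>\<^sup>2) * (51 / 100 * \<epsilon>)"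
  proof (rule mult_mono)
    show "\<epsilon>\<^sup>2 / 5 + 2 * \<eta> \<le> 21 / 100 * \<epsilon>\<^sup>2"
      using \<eta> e3(1) by linarith
  qed (use b nonneg in auto)
  also have "\<dots> = 1071 / 10000 * \<epsilon> ^ 3"
    by (simp add: e3(3))
  finally have c': "c \<le> 1071 / 10000 * \<epsilon> ^ 3" .
  have "(1 + \<epsilon>) * c \<le> (1 + \<epsilon>) * (1071 / 10000 * \<epsilon> ^ 3)"
    using c' \<epsilon> by (intro mult_left_mono) auto
  also have "\<dots> \<le> (101 / 100) * (1071 / 10000 * \<epsilon> ^ 3)"
    using \<epsilon> by (intro mult_right_mono) auto
  finally have d: "d \<le> 1 / 4 * \<epsilon> ^ 3"
    using secondary e3 by linarith
  have t: "9 / 10 \<le> t"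
    using sum x u d e2 e3 \<epsilon> \<eta> by linarith
  from halt show False
  proof (elim disjE)
    assume "u = 0 \<and> t = 0"
    with t show False by simp
  next
    assume "\<epsilon> \<le> x"
    then have "\<epsilon> * (9 / 10) \<le> x * t"
      using t \<epsilon> by (intro mult_mono) auto
    then show False
      using prod a \<epsilon> by linarith
  next
    assume "\<epsilon> / 2 - \<eta> \<le> a"
    then have "(1 + \<epsilon>) * (\<epsilon> / 2 - \<eta>) \<le> (1 + \<epsilon>) * a"
      using \<epsilon> by (intro mult_left_mono) auto
    moreover have "\<epsilon> * \<eta> \<le> \<eta>"
      using \<epsilon> \<eta> by (intro mult_left_le_one_le) auto
    ultimately have "\<epsilon> / 2 + \<epsilon>\<^sup>2 / 2 - 2 * \<eta> \<le> (1 + \<epsilon>) * a"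
      by (simp add: algebra_simps power2_eq_square)
    \<comment> \<open>Uses \<open>x \<ge> b - u - d\<close>: the coefficient of \<epsilon>^2 is 1/2
      - 1/5 = 3/10, and lowering it to 29/100 absorbs all cubic terms.\<close>
    then have y: "\<epsilon> / 2 + 29 / 100 * \<epsilon>\<^sup>2 \<le> x" (is "?y \<le> x")
      using primary roots u d \<eta> e3 by linarith
    have m: "1 - 21 / 100 * \<epsilon>\<^sup>2 - x \<le> t"
      using sum u d \<eta> e3 by linarith
    let ?m = "1 - 21 / 100 * \<epsilon>\<^sup>2"
    \<comment> \<open>The parabola \<open>x * (?m - x)\<close> increases up to
      \<open>?m / 2\<close>; this factorisation shows that replacing \<open>x\<close> by its lower
      bound \<open>?y\<close> can only decrease it.\<close>
    have "0 \<le> (x - ?y) * (?m - x - ?y)"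
      using y x \<epsilon> e2 e3 \<eta> by (intro mult_nonneg_nonneg) linarith+
    moreover have "(x - y) * (m - x - y) = x * (m - x) - y * (m - y)" for y m :: real
      by (simp add: algebra_simps)
    ultimately have "?y * (?m - ?y) \<le> x * (?m - x)"
      by (simp only: diff_ge_0_iff_ge)
    also have "\<dots> \<le> x * t"
      using m nonneg by (intro mult_left_mono) auto
    finally have "?y * (?m - ?y) \<le> \<epsilon> / 2"
      using prod a by linarith
    \<comment> \<open>The surplus 4/100 is 29/100 - 1/4. For a target \<kappa> \<epsilon>^2 in place
      of \<epsilon>^2/5 it would be 1/4 - \<kappa> to leading order, so the method needs \<kappa> <
      1/4.\<close>
    moreover have "?y * (?m - ?y) = \<epsilon> / 2 + 4 / 100 * \<epsilon>\<^sup>2 - 395 / 1000 * \<epsilon> ^ 3 - 145 / 1000 * \<epsilon>\<^sup>2 * \<epsilon>\<^sup>2"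
      by (simp add: field_simps power2_eq_square power3_eq_cube)
    moreover have "\<epsilon>\<^sup>2 * \<epsilon>\<^sup>2 \<le> \<epsilon> * \<epsilon>\<^sup>2"
      using e2 \<epsilon> by (intro mult_right_mono) auto
    ultimately show False
      using e2 e3 by linarith
  qed
qed

section \<open>The parameters for the random graph and the limit\<close>

lemma of_nat_ceiling_le_add_one: "0 \<le> y \<Longrightarrow> real (nat \<lceil>y\<rceil>) \<le> y + 1" for y :: real
  by (simp add: of_int_ceiling_le_add_one of_nat_nat)

lemma induced_search_gnp:
  fixes \<epsilon> :: real and n :: nat
  assumes \<epsilon>: "0 < \<epsilon>" "\<epsilon> < 1 / 100" and n: "1000 \<le> \<epsilon> ^ 3 * real n"
  shows "induced_search n (Suc (nat \<lceil>\<epsilon>\<^sup>2 * real n / 5\<rceil>)) (nat \<lfloor>\<epsilon> * (real n)\<^sup>2 / 2\<rfloor>)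
    (nat \<lceil>\<epsilon> * real n\<rceil>) ((1 + \<epsilon>) / real n) (\<epsilon> ^ 3 * real n / 10)"
    (is "induced_search n (Suc ?k) ?N ?s ?p ?l")
proof
  have "\<epsilon> ^ 3 \<le> 1"
    using \<epsilon> by (intro power_le_one) auto
  then have "\<epsilon> ^ 3 * real n \<le> real n"
    using \<epsilon> by (intro mult_left_le_one_le) auto
  with n have n1000: "1000 \<le> real n"
    by linarith
  then have n_pos: "0 < real n"
    by linarith
  show "0 \<le> ?p" "?p \<le> 1" "0 < ?l" "0 < Suc ?k"
    using \<epsilon> n1000 n_pos by (auto simp: divide_le_eq)
  have k: "real ?k \<le> \<epsilon>\<^sup>2 * real n / 5 + 1"
    by (rule of_nat_ceiling_le_add_one) (use n_pos in simp)
  then have L: "real (Suc ?k) \<le> \<epsilon>\<^sup>2 * real n / 5 + 2"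
    unfolding of_nat_Suc by linarith
  have "real ?N \<le> \<epsilon> * (real n)\<^sup>2 / 2"
    by (rule of_nat_floor) (use \<epsilon> in simp)
  moreover have "\<epsilon> * (real n)\<^sup>2 / 2 - 1 \<le> real ?N"
    using \<epsilon> by (simp add: of_nat_nat)
  ultimately have N: "real ?N \<le> \<epsilon> * (real n)\<^sup>2 / 2" "\<epsilon> * (real n)\<^sup>2 / 2 - 1 \<le> real ?N" .
  have s: "real ?s \<le> \<epsilon> * real n + 1" "\<epsilon> * real n \<le> real ?s"
    using \<epsilon> n_pos by (auto intro: of_nat_ceiling_le_add_one of_nat_ceiling)
  fix x t u a b c d :: nat
  assume sum: "x + t + u + d = n" and roots: "b \<le> x + u + d" and prod: "x * t \<le> a"
    and u: "u < Suc ?k" and a: "a \<le> ?N" and x: "x \<le> ?s" and c: "c \<le> Suc ?k * b"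
    and halt: "a = ?N \<or> x = ?s \<or> u = 0 \<and> t = 0"
    and primary: "\<bar>real b - ?p * real a\<bar> \<le> ?l" and secondary: "\<bar>real d - ?p * real c\<bar> \<le> ?l"
  let ?f = "\<lambda>m. real m / real n" and ?g = "\<lambda>m. real m / (real n)\<^sup>2"
  have scale: "\<bar>?f i - (1 + \<epsilon>) * ?g j\<bar> \<le> \<epsilon> ^ 3 / 10" if "\<bar>real i - ?p * real j\<bar> \<le> ?l" for i j
  proof -
    have "?f i - (1 + \<epsilon>) * ?g j = (real i - ?p * real j) / real n"
      using n_pos by (simp add: field_simps power2_eq_square)
    then have "\<bar>?f i - (1 + \<epsilon>) * ?g j\<bar> = \<bar>real i - ?p * real j\<bar> / real n"
      using n_pos by (simp add: abs_divide)
    also have "\<dots> \<le> ?l / real n"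
      using that n_pos by (intro divide_right_mono) auto
    finally show ?thesis using n_pos by simp
  qed
  show False
  \<comment> \<open>Rounding changes a vertex count by at most 1, hence \<eta> = 1/n;
    \<open>Suc ?k\<close> carries both the ceiling and the extra vertex of a path of length
    \<open>?k\<close>, hence the 2 \<eta> in the bound on \<open>c\<close>.\<close>
  proof (rule no_dead_end_scaled[where \<epsilon> = \<epsilon> and \<eta> = "1 / real n" and x = "?f x" and t = "?f t"
        and u = "?f u" and d = "?f d" and b = "?f b" and a = "?g a" and c = "?g c"])
    show "1 / real n \<le> \<epsilon> ^ 3 / 1000"
      using n n_pos by (simp add: field_simps)
    show "?f x + ?f t + ?f u + ?f d = 1"
      using sum n_pos by (simp add: add_divide_distrib[symmetric] flip: of_nat_add)
    show "?f b \<le> ?f x + ?f u + ?f d"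
      using roots n_pos by (simp add: add_divide_distrib[symmetric] divide_right_mono flip: of_nat_add)
    show "?f x * ?f t \<le> ?g a"
      using prod n_pos by (simp add: power2_eq_square divide_right_mono flip: of_nat_mult)
    show "?f u \<le> \<epsilon>\<^sup>2 / 5 + 1 / real n"
    proof -
      have "real u \<le> \<epsilon>\<^sup>2 * real n / 5 + 1"
        using u k by linarith
      then show ?thesis using n_pos by (simp add: field_simps)
    qed
    show "?g a \<le> \<epsilon> / 2"
    proof -
      have "real a \<le> \<epsilon> * (real n)\<^sup>2 / 2"
        using a N by linarith
      then show ?thesis using n_pos by (simp add: field_simps)
    qed
    show "?f x \<le> \<epsilon> + 1 / real n"
    proof -
      have "real x \<le> \<epsilon> * real n + 1"
        using x s by linarith
      then show ?thesis using n_pos by (simp add: field_simps)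
    qed
    show "?g c \<le> (\<epsilon>\<^sup>2 / 5 + 2 * (1 / real n)) * ?f b"
    proof -
      have "real c \<le> real (Suc ?k * b)"
        using c by (rule of_nat_mono)
      also have "\<dots> = real (Suc ?k) * real b"
        by (rule of_nat_mult)
      also have "\<dots> \<le> (\<epsilon>\<^sup>2 * real n / 5 + 2) * real b"
        by (rule mult_right_mono[OF L]) simp
      finally have "?g c \<le> (\<epsilon>\<^sup>2 * real n / 5 + 2) * real b / (real n)\<^sup>2"
        by (rule divide_right_mono) simp
      also have "\<dots> = (\<epsilon>\<^sup>2 / 5 + 2 * (1 / real n)) * ?f b"
        using n_pos by (simp add: field_simps power2_eq_square)
      finally show ?thesis .
    qed
    show "\<epsilon> / 2 - 1 / real n \<le> ?g a \<or> \<epsilon> \<le> ?f x \<or> ?f u = 0 \<and> ?f t = 0"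
      using halt
    proof (elim disjE)
      assume "a = ?N"
      then have "(\<epsilon> * (real n)\<^sup>2 / 2 - 1) / (real n)\<^sup>2 \<le> ?g a"
        using N by (intro divide_right_mono) auto
      moreover have "(\<epsilon> * (real n)\<^sup>2 / 2 - 1) / (real n)\<^sup>2 = \<epsilon> / 2 - 1 / (real n)\<^sup>2"
        using n_pos by (simp add: field_simps)
      moreover have "1 / (real n)\<^sup>2 \<le> 1 / real n"
        using n1000 by (intro divide_left_mono) (auto simp: power2_eq_square)
      ultimately show ?thesis by linarith
    next
      assume "x = ?s"
      then show ?thesis using s n_pos by (simp add: pos_le_divide_eq)
    qed simp
  qed (use \<epsilon> scale[OF primary] scale[OF secondary] in simp_all)
qed

text \<open>A Chebyshev bound: the initial state has no deviation, so its risk is the whole variance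
  budget \<open>p * (N + L * n)\<close> divided by the squared tolerance.\<close>

lemma prob_long_induced_path:
  fixes \<epsilon> :: real and n :: nat
  assumes \<epsilon>: "0 < \<epsilon>" "\<epsilon> < 1 / 100" and n: "1000 \<le> \<epsilon> ^ 3 * real n"
  shows "1 - 300 / \<epsilon> ^ 6 / real n \<le> measure_pmf.prob (gnp n ((1 + \<epsilon>) / real n))
          {E. has_induced_path_of_length {..<n} E (nat \<lceil>\<epsilon>\<^sup>2 * real n / 5\<rceil>)}"
proof -
  let ?k = "nat \<lceil>\<epsilon>\<^sup>2 * real n / 5\<rceil>" and ?N = "nat \<lfloor>\<epsilon> * (real n)\<^sup>2 / 2\<rfloor>"
    and ?s = "nat \<lceil>\<epsilon> * real n\<rceil>" and ?p = "(1 + \<epsilon>) / real n" and ?l = "\<epsilon> ^ 3 * real n / 10"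
  interpret induced_search n "Suc ?k" ?N ?s ?p ?l
    by (rule induced_search_gnp[OF assms])
  have n_pos: "0 < real n"
    using n \<epsilon> by (cases n) auto
  have e3: "\<epsilon> ^ 3 \<le> 1 / 100"
    using power_mono[of \<epsilon> "1 / 100" 3] \<epsilon> by (simp add: power3_eq_cube)
  then have "\<epsilon> ^ 3 * real n \<le> 1 / 100 * real n"
    by (intro mult_right_mono) auto
  with n have n1000: "1000 \<le> real n"
    by linarith
  have "search_inv [] {..<n} {} {} {} {} 0 0"
    by (simp add: search_inv_def)
  from success_search[OF this]
  have "1 - risk 0 0 0 0 \<le> success (pairs n) {}"
    by simp
  also have "success (pairs n) {} = measure_pmf.prob (gnp n ?p)
      {E. has_induced_path_of_length {..<n} E ?k}"
    by (simp add: success_def has_induced_path_of_length_def gnp_eq_random_subset)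
  finally have *: "1 - risk 0 0 0 0 \<le> \<dots>" .
  have "?p * real ?N \<le> ?p * (\<epsilon> * (real n)\<^sup>2 / 2)"
    using \<epsilon> n_pos by (intro mult_left_mono of_nat_floor) simp_all
  also have "\<dots> = (1 + \<epsilon>) * (\<epsilon> / 2) * real n"
    using n_pos by (simp add: field_simps power2_eq_square)
  also have "\<dots> \<le> 1 * real n"
    using \<epsilon> mult_mono[of "1 + \<epsilon>" 2 "\<epsilon> / 2" "1 / 2"] by (intro mult_right_mono) auto
  finally have N: "?p * real ?N \<le> real n" by simp
  have "\<epsilon>\<^sup>2 \<le> 1"
    using \<epsilon> by (intro power_le_one) auto
  then have "\<epsilon>\<^sup>2 * real n \<le> real n"
    using \<epsilon> by (intro mult_left_le_one_le) auto
  moreover have "real ?k \<le> \<epsilon>\<^sup>2 * real n / 5 + 1"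
    by (rule of_nat_ceiling_le_add_one) simp
  ultimately have "real (Suc ?k) \<le> real n"
    using n1000 unfolding of_nat_Suc by linarith
  then have "(1 + \<epsilon>) * real (Suc ?k) \<le> 2 * real n"
    by (rule mult_mono[rotated]) (use \<epsilon> of_nat_0_le_iff in \<open>linarith+\<close>)
  moreover have "?p * real (Suc ?k * n) = (1 + \<epsilon>) * real (Suc ?k)"
    unfolding of_nat_mult using n_pos by (simp del: of_nat_Suc)
  \<comment> \<open>The primary budget contributes at most n and the secondary one at most
    2n.\<close>
  ultimately have "risk 0 0 0 0 \<le> (real n + 2 * real n) / ?l\<^sup>2"
    unfolding risk_def using N by (intro divide_right_mono) (simp_all del: of_nat_mult of_nat_Suc)
  also have "\<dots> = 300 / \<epsilon> ^ 6 / real n"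
    using n_pos \<epsilon> by (simp add: field_simps power2_eq_square)
  finally show ?thesis using * by linarith
qed

theorem theorem1p3:
  "\<exists>\<epsilon>\<^sub>0::real. \<epsilon>\<^sub>0 > 0 \<and>
     (\<forall>\<epsilon>::real. 0 < \<epsilon> \<and> \<epsilon> < \<epsilon>\<^sub>0 \<longrightarrow>
       (\<lambda>n::nat. measure_pmf.prob (gnp n ((1 + \<epsilon>) / real n))
          {E. has_induced_path_of_length {..<n} E (nat \<lceil>\<epsilon>\<^sup>2 * real n / 5\<rceil>)})
         \<longlonglongrightarrow> 1)"
\<comment> \<open>The threshold is the one under which the numerical estimates absorb cubic terms
  into multiples of \<epsilon>^2.\<close>
proof (intro exI[of _ "1 / 100"] conjI allI impI)
  fix \<epsilon> :: real
  assume \<epsilon>: "0 < \<epsilon> \<and> \<epsilon> < 1 / 100"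
  have large: "\<forall>\<^sub>F n in sequentially. 1000 \<le> \<epsilon> ^ 3 * real n"
    using \<epsilon> eventually_ge_at_top[of "nat \<lceil>1000 / \<epsilon> ^ 3\<rceil>"]
    by (auto elim!: eventually_mono simp: nat_le_iff ceiling_le_iff pos_divide_le_eq mult.commute)
  show "(\<lambda>n::nat. measure_pmf.prob (gnp n ((1 + \<epsilon>) / real n))
          {E. has_induced_path_of_length {..<n} E (nat \<lceil>\<epsilon>\<^sup>2 * real n / 5\<rceil>)}) \<longlonglongrightarrow> 1"
  proof (rule tendsto_sandwich[where h = "\<lambda>_. 1"])
    show "\<forall>\<^sub>F n in sequentially. 1 - 300 / \<epsilon> ^ 6 / real n \<le>
        measure_pmf.prob (gnp n ((1 + \<epsilon>) / real n))
          {E. has_induced_path_of_length {..<n} E (nat \<lceil>\<epsilon>\<^sup>2 * real n / 5\<rceil>)}"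
      using large by eventually_elim (use \<epsilon> prob_long_induced_path in auto)
    show "(\<lambda>n. 1 - 300 / \<epsilon> ^ 6 / real n) \<longlonglongrightarrow> 1"
      using tendsto_diff[OF tendsto_const lim_const_over_n[of "300 / \<epsilon> ^ 6"], of 1] by simp
  qed (simp_all add: measure_pmf.prob_le_1)
qed simp

end
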